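(* Let $\{\theta_i^*,\ i=1,\ldots,n\}$ be any stable fixed point solution to the Kuramoto model with adjacency matrix $(A_{ij})$, natural frequencies $\omega_1,\ldots,\omega_n$ and coupling constant $k$, and write $\Delta^*_{ji}=\theta_j^*(t)-\theta_i^*(t)$ (which is independent of $t$). Then $$\bar\omega=\omega_i+k\sum_{j=1}^n A_{ij}\sin(\Delta^*_{ji}),\qquad i=1,\ldots,n,$$ and for any non-empty node subset $S\subseteq\{1,\ldots,n\}$, $$\sum_{i\in S}\sum_{j\in S^c}A_{ij}\cos(\Delta^*_{ji})\ge 0,$$ where $S^c=\{1,\ldots,n\}\setminus S$.
   Context: The Kuramoto model on a finite simple undirected network with nodes $1,\ldots,n$ and symmetric $0/1$ adjacency matrix $A=(A_{ij})$ (with $A_{ii}=0$) is the system $$\dot\theta_i=\omega_i+k\sum_{j=1}^n A_{ij}\sin(\theta_j-\theta_i),\qquad i=1,\ldots,n,$$ where the $\theta_i=\theta_i(t)$ are phase angles (taken over the full circle, i.e. range $-\pi$ to $\pi$, modulo $2\pi$), the real constants $\omega_i$ are natural frequencies, and $k>0$ is the coupling constant. Put $\bar\omega=\frac1n\sum_{j=1}^n\omega_j$. A fixed point (frequency fixed point) is a solution $\{\theta_i^*\}$ of this system with $\dot\theta_i^*(t)=\bar\omega$ for all $i=1,\ldots,n$ (and all $t$); all phase differences $\Delta^*_{ji}=\theta_j^*(t)-\theta_i^*(t)$ are then constant in time. A fixed point is called stable if it is (linearly) stable in the following sense: all eigenvalues of the real symmetric $n\times n$ matrix $M$ with entries $$M_{ij}=A_{ij}\cos(\Delta^*_{ji})-\delta_{ij}\sum_{l=1}^n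 A_{il}\cos(\Delta^*_{li})$$ are less than or equal to zero (here $\delta_{ij}$ is the Kronecker delta); $M$ is, up to the factor $k$, the matrix of the linearization of the system at the fixed point. *)

theory Defs
  imports "HOL-Analysis.Analysis"
begin

(* Nodes are the elements of a finite (hence non-empty) type 'n, so n = CARD('n). *)

definition simple_adjacency_matrix :: "real ^ 'n ^ 'n \<Rightarrow> bool" where
  "simple_adjacency_matrix A \<longleftrightarrow>
     (\<forall>i j. A $ i $ j = 0 \<or> A $ i $ j = 1) \<and> (\<forall>i j. A $ i $ j = A $ j $ i) \<and> (\<forall>i. A $ i $ i = 0)"

definition mean_frequency :: "real ^ 'n \<Rightarrow> real" where
  "mean_frequency \<omega> = (\<Sum>j\<in>UNIV. \<omega> $ j) / real CARD('n)"

(* The phases are angles modulo 2 * pi; a trajectory is represented by a differentiable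
   real-valued lift, defined for all times. *)
definition kuramoto_solution ::
    "real ^ 'n ^ 'n \<Rightarrow> real ^ 'n \<Rightarrow> real \<Rightarrow> (real \<Rightarrow> real ^ 'n) \<Rightarrow> bool" where
  "kuramoto_solution A \<omega> k \<theta> \<longleftrightarrow>
     (\<forall>t i. ((\<lambda>s. \<theta> s $ i) has_real_derivative
        (\<omega> $ i + k * (\<Sum>j\<in>UNIV. A $ i $ j * sin (\<theta> t $ j - \<theta> t $ i)))) (at t))"

definition kuramoto_fixed_point ::
    "real ^ 'n ^ 'n \<Rightarrow> real ^ 'n \<Rightarrow> real \<Rightarrow> (real \<Rightarrow> real ^ 'n) \<Rightarrow> bool" where
  "kuramoto_fixed_point A \<omega> k \<theta> \<longleftrightarrow>
     kuramoto_solution A \<omega> k \<theta> \<and>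
     (\<forall>t i. ((\<lambda>s. \<theta> s $ i) has_real_derivative mean_frequency \<omega>) (at t))"

(* The linearization of the system at the phase configuration x, up to the factor k. *)
definition stability_matrix :: "real ^ 'n ^ 'n \<Rightarrow> real ^ 'n \<Rightarrow> real ^ 'n ^ 'n" where
  "stability_matrix A x =
     (\<chi> i j. A $ i $ j * cos (x $ j - x $ i)
        - (if i = j then \<Sum>l\<in>UNIV. A $ i $ l * cos (x $ l - x $ i) else 0))"

(* Only real eigenvalues, which are all of them for the (symmetric) matrices considered here. *)
definition real_eigenvalue :: "real ^ 'n ^ 'n \<Rightarrow> real \<Rightarrow> bool" where
  "real_eigenvalue M \<mu> \<longleftrightarrow> (\<exists>v. v \<noteq> 0 \<and> M *v v = \<mu> *\<^sub>R v)"

(* The phase differences of a fixed point do not depend on time, so neither does the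
   stability matrix, and quantifying over t imposes the same condition as any single t. *)
definition stable_kuramoto_fixed_point ::
    "real ^ 'n ^ 'n \<Rightarrow> real ^ 'n \<Rightarrow> real \<Rightarrow> (real \<Rightarrow> real ^ 'n) \<Rightarrow> bool" where
  "stable_kuramoto_fixed_point A \<omega> k \<theta> \<longleftrightarrow>
     kuramoto_fixed_point A \<omega> k \<theta> \<and>
     (\<forall>t \<mu>. real_eigenvalue (stability_matrix A (\<theta> t)) \<mu> \<longrightarrow> \<mu> \<le> 0)"

end

theory Submission
  imports Defs
begin

text \<open>
  The differential equation and the definition of a fixed point give two expressions for the same
  derivative, so the frequency identity is uniqueness of derivatives, and phase differences are
  constant because all phases move at the same speed.

  The cut inequality is the variational characterisation of the largest eigenvalue. If \<open>M\<close> is the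
  stability matrix and \<open>1\<^sub>S\<close> the indicator vector of \<open>S\<close>, then the quadratic form of \<open>M\<close> at \<open>1\<^sub>S\<close> is
  minus the sum of \<open>A\<^sub>i\<^sub>j cos (\<theta>\<^sub>j - \<theta>\<^sub>i)\<close> over the edges leaving \<open>S\<close>: the weights of edges inside
  \<open>S\<close> occur once off the diagonal and once, negatively, in the diagonal row sums
  (\<open>stability_form_indicator\<close>). It remains to see that a symmetric matrix without positive
  eigenvalues has a nonpositive quadratic form (\<open>quadratic_form_nonpos_if_eigenvalues_nonpos\<close>).
  This holds because a maximiser of the form on the unit sphere is an eigenvector whose eigenvalue
  is the maximum (\<open>max_eigenvector_exists\<close>).
\<close>

text \<open>
  A null vector of a positive semidefinite form is in the kernel of its matrix: otherwise moving
  from \<open>v\<close> a little in the direction \<open>- (B *v v)\<close> would make the form negative.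
\<close>

lemma psd_null_vector_in_kernel:
  fixes B :: "real ^ 'n ^ 'n"
  assumes sym: "transpose B = B"
    and psd: "\<And>x. x \<bullet> (B *v x) \<ge> 0"
    and null: "v \<bullet> (B *v v) = 0"
  shows "B *v v = 0"
proof (rule ccontr)
  define w where "w = B *v v"
  define q where "q = w \<bullet> (B *v w)"
  assume "B *v v \<noteq> 0"
  then have wpos: "w \<bullet> w > 0" by (simp add: w_def)
  have q0: "q \<ge> 0" unfolding q_def by (rule psd)
  have cross: "v \<bullet> (B *v w) = w \<bullet> w"
    using dot_lmul_matrix[of v B w] sym
    by (metis transpose_matrix_vector w_def)
  have expand: "(v - s *\<^sub>R w) \<bullet> (B *v (v - s *\<^sub>R w)) = s\<^sup>2 * q - 2 * s * (w \<bullet> w)" for s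
  proof -
    have "B *v (v - s *\<^sub>R w) = w - s *\<^sub>R (B *v w)"
      by (simp add: w_def matrix_vector_mult_diff_distrib matrix_vector_mult_scaleR)
    then show ?thesis
      using null cross
      by (simp add: inner_diff_left inner_diff_right q_def w_def[symmetric] power2_eq_square
          inner_commute algebra_simps)
  qed
  \<comment> \<open>The quadratic in \<open>s\<close> has negative slope at \<open>0\<close>; adding \<open>1\<close> keeps the denominator positive.\<close>
  define s where "s = (w \<bullet> w) / (q + 1)"
  have spos: "s > 0" using wpos q0 by (simp add: s_def)
  have "s * (q + 1) = w \<bullet> w" using q0 by (simp add: s_def)
  then have "s * q < w \<bullet> w" using spos by (simp add: algebra_simps)
  then have "s * q - 2 * (w \<bullet> w) < 0" using wpos by linarith
  then have "s * (s * q - 2 * (w \<bullet> w)) < 0" using spos by (simp add: mult_pos_neg)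
  then have "s\<^sup>2 * q - 2 * s * (w \<bullet> w) < 0" by (simp add: power2_eq_square algebra_simps)
  with psd[of "v - s *\<^sub>R w"] expand[of s] show False by linarith
qed

text \<open>
  The unit sphere is compact, so the form attains its maximum \<open>\<mu>\<close> there, at \<open>v\<close> say. Then
  \<open>\<mu> I - M\<close> is positive semidefinite with null vector \<open>v\<close>.
\<close>

lemma max_eigenvector_exists:
  fixes M :: "real ^ 'n ^ 'n"
  assumes sym: "transpose M = M"
  obtains \<mu> where "real_eigenvalue M \<mu>" "\<And>x. x \<bullet> (M *v x) \<le> \<mu> * (x \<bullet> x)"
proof -
  have "continuous_on (sphere 0 1) (\<lambda>x. x \<bullet> (M *v x))"
    by (intro continuous_intros linear_continuous_on matrix_vector_mul_bounded_linear)
  moreover have "sphere 0 1 \<noteq> ({} :: (real ^ 'n) set)" by simp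
  ultimately have "\<exists>v\<in>sphere 0 1. \<forall>y\<in>sphere 0 1. y \<bullet> (M *v y) \<le> v \<bullet> (M *v v)"
    by (intro continuous_attains_sup compact_sphere)
  then obtain v where v: "v \<in> sphere 0 1"
    and vmax: "\<And>y. y \<in> sphere 0 1 \<Longrightarrow> y \<bullet> (M *v y) \<le> v \<bullet> (M *v v)"
    by blast
  define \<mu> where "\<mu> = v \<bullet> (M *v v)"
  have vv: "v \<bullet> v = 1" using v by (simp add: dot_square_norm)
  have bound: "x \<bullet> (M *v x) \<le> \<mu> * (x \<bullet> x)" for x
  proof (cases "x = 0")
    case False
    have "sgn x \<in> sphere 0 1" using False by (simp add: norm_sgn)
    then have "sgn x \<bullet> (M *v sgn x) \<le> \<mu>" using vmax \<mu>_def by blast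
    then have "(norm x)\<^sup>2 * (sgn x \<bullet> (M *v sgn x)) \<le> (norm x)\<^sup>2 * \<mu>"
      by (simp add: mult_left_mono)
    moreover have "(norm x)\<^sup>2 * (sgn x \<bullet> (M *v sgn x))
        = (norm x *\<^sub>R sgn x) \<bullet> (M *v (norm x *\<^sub>R sgn x))"
      by (simp add: matrix_vector_mult_scaleR power2_eq_square)
    moreover have "norm x *\<^sub>R sgn x = x" using False by (simp add: sgn_div_norm)
    ultimately show ?thesis by (simp add: dot_square_norm mult.commute)
  qed simp
  define B where "B = mat \<mu> - M"
  have "mat \<mu> *v x = \<mu> *\<^sub>R x" for x
    by (simp add: matrix_vector_mult_def mat_def vec_eq_iff if_distribR if_distrib[of "\<lambda>c. c * _"]
        cong: if_cong)
  then have Bv: "B *v x = \<mu> *\<^sub>R x - M *v x" for x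
    by (simp add: B_def matrix_vector_mult_diff_rdistrib)
  have "transpose B = B"
    using sym by (simp add: B_def transpose_def mat_def vec_eq_iff)
  moreover have "x \<bullet> (B *v x) \<ge> 0" for x
    using bound[of x] by (simp add: Bv inner_diff_right)
  moreover have "v \<bullet> (B *v v) = 0"
    by (simp add: Bv inner_diff_right vv \<mu>_def)
  ultimately have "B *v v = 0" by (rule psd_null_vector_in_kernel)
  then have "M *v v = \<mu> *\<^sub>R v" by (simp add: Bv)
  moreover have "v \<noteq> 0" using vv by auto
  ultimately have "real_eigenvalue M \<mu>" unfolding real_eigenvalue_def by blast
  then show ?thesis using bound by (rule that)
qed

lemma quadratic_form_nonpos_if_eigenvalues_nonpos:
  fixes M :: "real ^ 'n ^ 'n"
  assumes "transpose M = M" and "\<And>\<mu>. real_eigenvalue M \<mu> \<Longrightarrow> \<mu> \<le> 0"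
  shows "x \<bullet> (M *v x) \<le> 0"
proof -
  obtain \<mu> where "real_eigenvalue M \<mu>" and le: "\<And>x. x \<bullet> (M *v x) \<le> \<mu> * (x \<bullet> x)"
    using max_eigenvector_exists[OF assms(1)] by blast
  then have "\<mu> * (x \<bullet> x) \<le> 0" using assms(2) by (simp add: mult_nonpos_nonneg)
  with le[of x] show ?thesis by linarith
qed

lemma transpose_stability_matrix:
  assumes "simple_adjacency_matrix A"
  shows "transpose (stability_matrix A x) = stability_matrix A x"
proof -
  have "cos (x $ i - x $ j) = cos (x $ j - x $ i)" for i j
    by (metis cos_minus minus_diff_eq)
  moreover have "A $ i $ j = A $ j $ i" for i j
    using assms by (simp add: simple_adjacency_matrix_def)
  ultimately show ?thesis
    by (auto simp: stability_matrix_def transpose_def vec_eq_iff)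
qed

text \<open>
  Row \<open>i\<close> of the stability matrix sums to zero, so for \<open>i\<close> in \<open>S\<close> the entries with column in \<open>S\<close>
  add up to minus the entries with column outside \<open>S\<close>, and the latter are off the diagonal.
\<close>

lemma stability_form_indicator:
  fixes A :: "real ^ 'n ^ 'n"
  defines "indic \<equiv> \<lambda>S. (\<chi> i. if i \<in> S then 1 else 0) :: real ^ 'n"
  shows "indic S \<bullet> (stability_matrix A x *v indic S) =
    - (\<Sum>i\<in>S. \<Sum>j\<in>- S. A $ i $ j * cos (x $ j - x $ i))"
proof -
  define a where "a i j = A $ i $ j * cos (x $ j - x $ i)" for i j
  have row: "(stability_matrix A x *v indic S) $ i = - (\<Sum>j\<in>- S. a i j)" if "i \<in> S" for i
  proof -
    have "(stability_matrix A x *v indic S) $ i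
        = (\<Sum>j\<in>UNIV. if j \<in> S then a i j - (if i = j then \<Sum>l\<in>UNIV. a i l else 0) else 0)"
      by (simp add: matrix_vector_mult_def stability_matrix_def indic_def a_def
          if_distrib[of "\<lambda>c. _ * c"] cong: if_cong)
    also have "\<dots> = (\<Sum>j\<in>S. a i j - (if i = j then \<Sum>l\<in>UNIV. a i l else 0))"
      by (simp add: sum.inter_restrict[symmetric, of UNIV S, simplified])
    also have "\<dots> = (\<Sum>j\<in>S. a i j) - (\<Sum>l\<in>UNIV. a i l)"
      using that by (simp add: sum_subtractf)
    also have "(\<Sum>l\<in>UNIV. a i l) = (\<Sum>j\<in>S. a i j) + (\<Sum>j\<in>- S. a i j)"
      using sum.subset_diff[of S UNIV "a i"] by (simp add: Compl_eq_Diff_UNIV)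
    finally show ?thesis by simp
  qed
  have "indic S \<bullet> (stability_matrix A x *v indic S)
      = (\<Sum>i\<in>UNIV. if i \<in> S then (stability_matrix A x *v indic S) $ i else 0)"
    by (simp add: inner_vec_def indic_def if_distrib[of "\<lambda>c. c * _"] cong: if_cong)
  also have "\<dots> = (\<Sum>i\<in>S. (stability_matrix A x *v indic S) $ i)"
    by (simp add: sum.inter_restrict[symmetric, of UNIV S, simplified])
  also have "\<dots> = - (\<Sum>i\<in>S. \<Sum>j\<in>- S. a i j)"
    by (simp add: row sum_negf)
  finally show ?thesis by (simp add: a_def)
qed

theorem lemma2p1:
  fixes A :: "real ^ 'n ^ 'n" and \<omega> :: "real ^ 'n" and k :: real
    and \<theta> :: "real \<Rightarrow> real ^ 'n"
  assumes "simple_adjacency_matrix A"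
    and "k > 0"
    and "stable_kuramoto_fixed_point A \<omega> k \<theta>"
  shows "(\<forall>s t i j. \<theta> s $ j - \<theta> s $ i = \<theta> t $ j - \<theta> t $ i) \<and>
    (\<forall>t i. mean_frequency \<omega> = \<omega> $ i + k * (\<Sum>j\<in>UNIV. A $ i $ j * sin (\<theta> t $ j - \<theta> t $ i))) \<and>
    (\<forall>t S. S \<noteq> {} \<longrightarrow> (\<Sum>i\<in>S. \<Sum>j\<in>- S. A $ i $ j * cos (\<theta> t $ j - \<theta> t $ i)) \<ge> 0)"
proof (intro conjI allI impI)
  have speed: "((\<lambda>s. \<theta> s $ i) has_real_derivative mean_frequency \<omega>) (at t)" for t i
    using assms(3) by (simp add: stable_kuramoto_fixed_point_def kuramoto_fixed_point_def)
  show "\<theta> s $ j - \<theta> s $ i = \<theta> t $ j - \<theta> t $ i" for s t i j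
  proof -
    have "\<forall>u. ((\<lambda>u. \<theta> u $ j - \<theta> u $ i) has_real_derivative 0) (at u)"
      using DERIV_diff[OF speed speed] by simp
    then show ?thesis by (rule DERIV_isconst_all)
  qed
  show "mean_frequency \<omega> = \<omega> $ i + k * (\<Sum>j\<in>UNIV. A $ i $ j * sin (\<theta> t $ j - \<theta> t $ i))" for t i
    using assms(3)
    unfolding stable_kuramoto_fixed_point_def kuramoto_fixed_point_def kuramoto_solution_def
    by (blast intro: DERIV_unique[OF speed])
  show "(\<Sum>i\<in>S. \<Sum>j\<in>- S. A $ i $ j * cos (\<theta> t $ j - \<theta> t $ i)) \<ge> 0" for t S
  proof -
    have "x \<bullet> (stability_matrix A (\<theta> t) *v x) \<le> 0" for x
      using assms(3) transpose_stability_matrix[OF assms(1)]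
      unfolding stable_kuramoto_fixed_point_def
      by (blast intro: quadratic_form_nonpos_if_eigenvalues_nonpos)
    from this[of "\<chi> i. if i \<in> S then 1 else 0"] show ?thesis
      by (simp only: stability_form_indicator neg_le_0_iff_le)
  qed
qed

end
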